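(* Let $f\in L^1(\mathbb{R}^d)$ be a non-negative function with mass $\|f\|_1\le m_c$, and let $\beta\ge1$ be such that the mass of $f_\infty^\beta$ is equal to that of $f$. Then $$H(f)-H(f_\infty^\beta)\ge C\,\|f-f_\infty^\beta\|_1^2$$ for some $C>0$ which depends only on $\|f_\infty^\beta\|_1$ and $\|f_\infty^\beta\|_2$.
   Context: Here $d\ge1$, $\|\cdot\|_p$ is the usual $L^p(\mathbb{R}^d)$ norm, and the mass of a non-negative function is its integral over $\mathbb{R}^d$. For $\beta\ge1$, $$f_\infty^\beta(v):=\frac{1}{\beta\exp(|v|^2/2)-1},\qquad v\in\mathbb{R}^d.$$ The critical mass is $m_c:=\int_{\mathbb{R}^d}f_\infty^1(v)\,\mathrm{d}v$, which is finite for $d\ge3$ and equals $+\infty$ for $d=1,2$. The entropy functional is $$H(f)=\int_{\mathbb{R}^d}\Big[\frac{|v|^2}{2}f(v)+f(v)\log f(v)-(f(v)+1)\log(f(v)+1)\Big]\,\mathrm{d}v .$$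
   Formalization: Positivity of C is claimed only when ‖f_∞^β‖_2 is finite; when it is infinite (β=1, d=3 or 4) no positive C exists, and only a constant C≥0 is asserted there. *)

theory Defs
  imports "HOL-Analysis.Analysis"
begin

text \<open>
  The dimension is a natural number and not a type because the constant of the inequality must not
  depend on it, so it has to be chosen before the dimension. A vector of \<open>\<real>\<^sup>d\<close> is an extensional
  function on \<open>{..<d}\<close>, and Lebesgue measure is the completion of the product of \<open>d\<close> copies of
  the Borel-Lebesgue measure on the line.
\<close>

definition leb :: "nat \<Rightarrow> (nat \<Rightarrow> real) measure" where
  "leb d = completion (Pi\<^sub>M {..<d} (\<lambda>_. lborel))"

definition norm_sq :: "nat \<Rightarrow> (nat \<Rightarrow> real) \<Rightarrow> real" where
  "norm_sq d v = (\<Sum>i<d. (v i)\<^sup>2)"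

text \<open>\<open>\<parallel>u\<parallel>\<^sub>p\<close> with values in \<open>[0, \<infinity>]\<close>.\<close>

definition Lnorm :: "nat \<Rightarrow> real \<Rightarrow> ((nat \<Rightarrow> real) \<Rightarrow> real) \<Rightarrow> ennreal" where
  "Lnorm d p u =
     (let I = (\<integral>\<^sup>+ v. ennreal (\<bar>u v\<bar> powr p) \<partial>leb d)
      in if I = \<infinity> then \<infinity> else ennreal (enn2real I powr (1 / p)))"

text \<open>Only meant for functions that are non-negative almost everywhere.\<close>

definition mass :: "nat \<Rightarrow> ((nat \<Rightarrow> real) \<Rightarrow> real) \<Rightarrow> ennreal" where
  "mass d f = (\<integral>\<^sup>+ v. ennreal (f v) \<partial>leb d)"

text \<open>
  For \<open>\<beta> = 1\<close> the formula is singular at the origin, where Isabelle's division gives \<open>0\<close>; this is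
  a null set for \<open>d \<ge> 1\<close>.
\<close>

definition f_inf :: "nat \<Rightarrow> real \<Rightarrow> (nat \<Rightarrow> real) \<Rightarrow> real" where
  "f_inf d \<beta> v = 1 / (\<beta> * exp (norm_sq d v / 2) - 1)"

definition critical_mass :: "nat \<Rightarrow> ennreal" where
  "critical_mass d = mass d (f_inf d 1)"

definition entropy_density :: "nat \<Rightarrow> ((nat \<Rightarrow> real) \<Rightarrow> real) \<Rightarrow> (nat \<Rightarrow> real) \<Rightarrow> real" where
  "entropy_density d f v =
     norm_sq d v / 2 * f v + f v * ln (f v) - (f v + 1) * ln (f v + 1)"

text \<open>
  For \<open>f \<ge> 0\<close> the integrand is bounded below by the integrable function
  \<open>ln (1 - exp (- \<bar>v\<bar>\<^sup>2 / 2))\<close>, but it need not be integrable (\<open>f\<close> may have an infinite second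
  moment), so \<open>H\<close> takes values in \<open>(-\<infinity>, \<infinity>]\<close>. It is the integral of the positive part minus the
  integral of the negative part, the latter being finite. The term \<open>f v * ln (f v)\<close> is \<open>0\<close> where
  \<open>f v = 0\<close>.
\<close>

definition H :: "nat \<Rightarrow> ((nat \<Rightarrow> real) \<Rightarrow> real) \<Rightarrow> ereal" where
  "H d f =
     enn2ereal (\<integral>\<^sup>+ v. ennreal (entropy_density d f v) \<partial>leb d)
     - enn2ereal (\<integral>\<^sup>+ v. ennreal (- entropy_density d f v) \<partial>leb d)"

end

theory Submission
  imports Defs
begin

text \<open>
  The entropy density is \<open>|v|\<^sup>2 / 2 * f + \<phi> f\<close> with \<open>\<phi>'(x) = ln (x / (x + 1))\<close>, so the equilibrium
  \<open>g = f_inf d \<beta>\<close> satisfies \<open>\<phi>'(g) = - |v|\<^sup>2 / 2 - ln \<beta>\<close>. As \<open>f\<close> and \<open>g\<close> have the same mass,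
  \<open>H f - H g\<close> is the integral of the Bregman divergence \<open>D\<close> of \<open>\<phi>\<close> between \<open>f\<close> and \<open>g\<close>. Since
  \<open>\<phi>''(x) = 1 / (x (x + 1))\<close> is decreasing, \<open>D \<ge> (g - f)\<^sup>2 / (2 g (g + 1))\<close> where \<open>f \<le> g\<close>, and by
  Cauchy-Schwarz \<open>(\<integral> (g - f)\<^sub>+)\<^sup>2 \<le> 2 * \<integral> D * \<integral> g (g + 1)\<close>. Equality of the masses gives
  \<open>\<parallel>f - g\<parallel>\<^sub>1 = 2 * \<integral> (g - f)\<^sub>+\<close>, which turns this into the claim.
\<close>

section \<open>The scalar Bregman divergence and its lower bounds\<close>

text \<open>With \<open>\<phi> x = x * ln x - (x + 1) * ln (x + 1)\<close>, this is
  \<open>\<phi> x - \<phi> y - \<phi>' y * (x - y)\<close> after simplification.\<close>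

definition bose_div :: "real \<Rightarrow> real \<Rightarrow> real" where
  "bose_div x y = x * (ln x - ln y) - (x + 1) * (ln (x + 1) - ln (y + 1))"

lemma bose_div_self [simp]: "bose_div y y = 0"
  by (simp add: bose_div_def)

lemma DERIV_bose_div:
  assumes "x > 0"
  shows "((\<lambda>x. bose_div x y) has_real_derivative (ln x - ln y) - (ln (x + 1) - ln (y + 1))) (at x)"
  unfolding bose_div_def
  by (rule derivative_eq_intros refl | use assms in \<open>simp; fail\<close>)+

text \<open>The divergence vanishes at \<open>x = y\<close>, and its derivative is non-negative to
  the right of \<open>y\<close> because \<open>x / (x + 1)\<close> is increasing.\<close>

lemma bose_div_ge_zero:
  assumes "y > 0" "y \<le> x"
  shows "bose_div x y \<ge> 0"
proof -
  have "bose_div y y \<le> bose_div x y"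
  proof (rule DERIV_nonneg_imp_nondecreasing[OF \<open>y \<le> x\<close>])
    fix t assume t: "y \<le> t" "t \<le> x"
    have "y * (t + 1) \<le> t * (y + 1)" using t by (simp add: algebra_simps)
    then have "ln (y * (t + 1)) \<le> ln (t * (y + 1))" using t assms by simp
    then have "(ln t - ln y) - (ln (t + 1) - ln (y + 1)) \<ge> 0"
      using t assms by (simp add: ln_mult)
    then show "\<exists>D. ((\<lambda>x. bose_div x y) has_real_derivative D) (at t) \<and> 0 \<le> D"
      using DERIV_bose_div[of t y] t assms by force
  qed
  then show ?thesis by simp
qed

text \<open>On \<open>(0, y]\<close> the second derivative \<open>1 / (x * (x + 1))\<close> is at
  least \<open>1 / (y * (y + 1))\<close>. The proof stays with first derivatives and uses
  \<open>ln z \<le> z - 1\<close>. The endpoint \<open>x = 0\<close>, where the divergence is not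
  differentiable, is treated separately.\<close>

lemma bose_div_ge_square:
  assumes y: "y > 0" and x: "0 \<le> x" "x \<le> y"
  shows "bose_div x y \<ge> (y - x)\<^sup>2 / (2 * (y * (y + 1)))"
proof (cases "x = 0")
  case True
  \<comment> \<open>At \<open>x = 0\<close> the divergence is \<open>ln (1 + y)\<close>, and the
    estimate \<open>ln (1 + y) \<ge> y / (y + 1)\<close> is twice what is required.\<close>
  have "- ln (1 + y) = ln (1 / (1 + y))" using y by (simp add: ln_div)
  also have "\<dots> \<le> 1 / (1 + y) - 1" using y by (intro ln_le_minus_one) simp
  finally have *: "y / (y + 1) \<le> ln (1 + y)" using y by (simp add: field_simps)
  have "y\<^sup>2 / (2 * (y * (y + 1))) = y / (y + 1) * (1 / 2)"
    using y by (simp add: power2_eq_square)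
  also have "\<dots> \<le> y / (y + 1)" using y by (intro mult_left_le) auto
  also note *
  finally show ?thesis using True by (simp add: bose_div_def add.commute)
next
  case False
  define K where "K = y * (y + 1)"
  have K: "K > 0" using y by (simp add: K_def)
  let ?h = "\<lambda>x. bose_div x y - (y - x)\<^sup>2 / (2 * K)"
  \<comment> \<open>\<open>?h y = 0\<close>, so it suffices that \<open>?h\<close> does not increase
    on \<open>[x, y]\<close>.\<close>
  have "?h x \<ge> ?h y"
  proof (rule DERIV_nonpos_imp_nonincreasing[OF \<open>x \<le> y\<close>])
    fix t assume "x \<le> t" "t \<le> y"
    then have t: "0 < t" "t \<le> y" using x False by auto
    have "ln (t * (y + 1) / (y * (t + 1))) \<le> t * (y + 1) / (y * (t + 1)) - 1"
      using t y by (intro ln_le_minus_one) simp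
    also have "\<dots> = (t * (y + 1) - y * (t + 1)) / (y * (t + 1))"
      using t y by (simp add: diff_divide_distrib)
    also have "\<dots> = - ((y - t) / (y * (t + 1)))"
      unfolding minus_divide_left by (simp add: algebra_simps)
    \<comment> \<open>Replacing \<open>t + 1\<close> by \<open>y + 1\<close> enlarges the
      denominator, and \<open>y - t \<ge> 0\<close>.\<close>
    also have "\<dots> \<le> - ((y - t) / K)"
      unfolding K_def neg_le_iff_le using t y by (intro divide_left_mono mult_left_mono) auto
    also have "ln (t * (y + 1) / (y * (t + 1))) = (ln t - ln y) - (ln (t + 1) - ln (y + 1))"
      using t y by (simp add: ln_div ln_mult)
    finally have "(ln t - ln y) - (ln (t + 1) - ln (y + 1)) + (y - t) / K \<le> 0" by simp
    moreover have "(?h has_real_derivative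
        (ln t - ln y) - (ln (t + 1) - ln (y + 1)) + (y - t) / K) (at t)"
      using K by (auto intro!: derivative_eq_intros DERIV_bose_div[OF t(1)] simp: field_simps)
    ultimately show "\<exists>D. (?h has_real_derivative D) (at t) \<and> D \<le> 0" by blast
  qed
  then show ?thesis by (simp add: K_def)
qed

lemma bose_div_nonneg:
  assumes "y > 0" "0 \<le> x"
  shows "bose_div x y \<ge> 0"
proof (cases "y \<le> x")
  case False
  have "0 \<le> (y - x)\<^sup>2 / (2 * (y * (y + 1)))" using assms by simp
  also have "\<dots> \<le> bose_div x y" using assms False by (intro bose_div_ge_square) auto
  finally show ?thesis .
qed (use assms bose_div_ge_zero in blast)

text \<open>Young's inequality applied to the quadratic bound. The free parameter \<open>a\<close>
  is chosen after integration, which recovers the Cauchy-Schwarz estimate from a pointwise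
  one.\<close>

lemma pos_part_le_bose_div:
  assumes y: "y > 0" and x: "0 \<le> x" and a: "a > 0"
  shows "max 0 (y - x) \<le> a * bose_div x y + y * (y + 1) / (2 * a)"
proof (cases "x \<le> y")
  case True
  define K where "K = y * (y + 1)"
  have K: "K > 0" using y by (simp add: K_def)
  have "0 \<le> (a * (y - x) - K)\<^sup>2 / (2 * a * K)" using a K by simp
  also have "\<dots> = a * ((y - x)\<^sup>2 / (2 * K)) + K / (2 * a) - (y - x)"
    using a K by (simp add: field_simps power2_eq_square)
  also have "\<dots> \<le> a * bose_div x y + K / (2 * a) - (y - x)"
    using mult_left_mono[OF bose_div_ge_square[OF y x True], of a] a by (simp add: K_def)
  finally show ?thesis using True by (simp add: K_def)
next
  case False
  then show ?thesis using bose_div_nonneg[OF y x] y a by simp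
qed

section \<open>Measurability, and pointwise identities for the equilibrium\<close>

lemma norm_sq_nonneg: "norm_sq d v \<ge> 0"
  by (simp add: norm_sq_def sum_nonneg)

lemma borel_measurable_norm_sq [measurable]: "norm_sq d \<in> borel_measurable (leb d)"
  unfolding leb_def by (rule measurable_completion) (unfold norm_sq_def, measurable)

lemma borel_measurable_f_inf [measurable]: "f_inf d \<beta> \<in> borel_measurable (leb d)"
  unfolding f_inf_def by measurable

lemma borel_measurable_entropy_density [measurable]:
  assumes [measurable]: "f \<in> borel_measurable (leb d)"
  shows "entropy_density d f \<in> borel_measurable (leb d)"
  unfolding entropy_density_def by measurable

text \<open>Only the origin is excluded; it is a product of null sets over a non-empty index set.
  This discards the point where \<open>f_inf d 1\<close> is singular.\<close>

lemma AE_norm_sq_pos: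
  assumes "d \<ge> 1"
  shows "AE v in leb d. norm_sq d v > 0"
proof -
  interpret product_sigma_finite "\<lambda>_::nat. lborel :: real measure" ..
  have "emeasure (Pi\<^sub>M {..<d} (\<lambda>_. lborel)) (Pi\<^sub>E {..<d} (\<lambda>_. {0::real})) = 0"
    using assms by (subst emeasure_PiM) (auto simp: lessThan_empty_iff)
  moreover have "Pi\<^sub>E {..<d} (\<lambda>_. {0::real}) \<in> sets (Pi\<^sub>M {..<d} (\<lambda>_. lborel))"
    by (intro sets_PiM_I_finite) auto
  ultimately have "Pi\<^sub>E {..<d} (\<lambda>_. {0::real}) \<in> null_sets (Pi\<^sub>M {..<d} (\<lambda>_. lborel))"
    by blast
  then have "AE v in Pi\<^sub>M {..<d} (\<lambda>_. lborel). norm_sq d v > 0"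
  proof (rule AE_I')
    show "{v \<in> space (Pi\<^sub>M {..<d} (\<lambda>_. lborel)). \<not> norm_sq d v > 0} \<subseteq> Pi\<^sub>E {..<d} (\<lambda>_. {0::real})"
    proof
      fix v assume v: "v \<in> {v \<in> space (Pi\<^sub>M {..<d} (\<lambda>_. lborel :: real measure)). \<not> norm_sq d v > 0}"
      then have "norm_sq d v = 0" using norm_sq_nonneg[of d v] by simp
      then have "\<forall>i<d. v i = 0" by (simp add: norm_sq_def sum_nonneg_eq_0_iff)
      then show "v \<in> Pi\<^sub>E {..<d} (\<lambda>_. {0})" using v by (auto simp: space_PiM PiE_iff extensional_def)
    qed
  qed
  then show ?thesis unfolding leb_def by (rule AE_completion)
qed

lemma f_inf_pos:
  assumes "norm_sq d v > 0" "\<beta> \<ge> 1"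
  shows "f_inf d \<beta> v > 0"
proof -
  have "1 * 1 < \<beta> * exp (norm_sq d v / 2)" using assms by (intro mult_le_less_imp_less) auto
  then show ?thesis by (simp add: f_inf_def)
qed

text \<open>The Euler-Lagrange equation of the equilibrium \<open>g\<close>, obtained by taking
  logarithms in \<open>g + 1 = \<beta> * exp (norm_sq d v / 2) * g\<close>. The multiplier of the
  mass constraint is \<open>ln \<beta>\<close>.\<close>

lemma ln_f_inf:
  assumes "norm_sq d v > 0" "\<beta> \<ge> 1"
  shows "ln (f_inf d \<beta> v + 1) - ln (f_inf d \<beta> v) = norm_sq d v / 2 + ln \<beta>"
proof -
  have pos: "f_inf d \<beta> v > 0" by (rule f_inf_pos[OF assms])
  then have "\<beta> * exp (norm_sq d v / 2) - 1 > 0" by (simp add: f_inf_def)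
  then have "f_inf d \<beta> v + 1 = \<beta> * exp (norm_sq d v / 2) * f_inf d \<beta> v"
    by (simp add: f_inf_def field_simps)
  then have "ln (f_inf d \<beta> v + 1) = ln (\<beta> * exp (norm_sq d v / 2) * f_inf d \<beta> v)" by simp
  also have "\<dots> = ln \<beta> + norm_sq d v / 2 + ln (f_inf d \<beta> v)"
    using assms pos by (simp add: ln_mult)
  finally show ?thesis by simp
qed

text \<open>Eliminating \<open>norm_sq d v / 2\<close> by the Euler-Lagrange equation leaves the
  divergence, a multiple of \<open>f v\<close>, and a term that depends on the equilibrium
  alone.\<close>

lemma entropy_density_eq_bose_div:
  assumes "norm_sq d v > 0" "\<beta> \<ge> 1"
  shows "entropy_density d f v =
    bose_div (f v) (f_inf d \<beta> v) - ln \<beta> * f v - ln (f_inf d \<beta> v + 1)"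
proof -
  have *: "norm_sq d v / 2 = ln (f_inf d \<beta> v + 1) - ln (f_inf d \<beta> v) - ln \<beta>"
    using ln_f_inf[OF assms] by simp
  show ?thesis unfolding entropy_density_def bose_div_def * by (simp add: algebra_simps)
qed

lemma entropy_density_f_inf:
  assumes "norm_sq d v > 0" "\<beta> \<ge> 1"
  shows "entropy_density d (f_inf d \<beta>) v = - ln \<beta> * f_inf d \<beta> v - ln (f_inf d \<beta> v + 1)"
  using entropy_density_eq_bose_div[OF assms, of "f_inf d \<beta>"] by simp

section \<open>The entropy and the norms as Bochner integrals\<close>

lemma H_eq_integral:
  assumes "integrable (leb d) (entropy_density d f)"
  shows "H d f = ereal (\<integral>v. entropy_density d f v \<partial>leb d)"
proof -
  let ?e = "entropy_density d f"
  obtain p n where pn: "(\<integral>\<^sup>+v. ennreal (?e v) \<partial>leb d) = ennreal p" "0 \<le> p"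
      "(\<integral>\<^sup>+v. ennreal (- ?e v) \<partial>leb d) = ennreal n" "0 \<le> n"
      "integral\<^sup>L (leb d) ?e = p - n"
    using integrableE[OF assms] by metis
  then show ?thesis by (simp add: H_def)
qed

text \<open>The integrable minorant makes the integral of the negative part finite, so integrability
  can fail only through the positive part.\<close>

lemma H_eq_PInf:
  assumes [measurable]: "f \<in> borel_measurable (leb d)"
    and not_int: "\<not> integrable (leb d) (entropy_density d f)"
    and u: "integrable (leb d) u" "AE v in leb d. u v \<le> entropy_density d f v"
  shows "H d f = \<infinity>"
proof -
  let ?e = "entropy_density d f"
  have "(\<integral>\<^sup>+v. ennreal (- ?e v) \<partial>leb d) \<le> (\<integral>\<^sup>+v. ennreal (norm (u v)) \<partial>leb d)"
    by (rule nn_integral_mono_AE) (use u(2) in eventually_elim, auto intro!: ennreal_leI)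
  also have "\<dots> < \<infinity>" using u(1) by (simp add: integrable_iff_bounded)
  finally have neg: "(\<integral>\<^sup>+v. ennreal (- ?e v) \<partial>leb d) < \<infinity>" .
  with not_int have "(\<integral>\<^sup>+v. ennreal (?e v) \<partial>leb d) = \<infinity>"
    by (auto simp: real_integrable_def)
  moreover obtain n where "(\<integral>\<^sup>+v. ennreal (- ?e v) \<partial>leb d) = ennreal n" "0 \<le> n"
    using neg by (cases "\<integral>\<^sup>+v. ennreal (- ?e v) \<partial>leb d") auto
  ultimately show ?thesis by (simp add: H_def)
qed

lemma Lnorm_1:
  assumes "integrable (leb d) u"
  shows "Lnorm d 1 u = ennreal (\<integral>v. \<bar>u v\<bar> \<partial>leb d)"
proof -
  have "(\<integral>\<^sup>+v. ennreal (\<bar>u v\<bar> powr 1) \<partial>leb d) = ennreal (\<integral>v. \<bar>u v\<bar> \<partial>leb d)"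
    using assms by (simp add: nn_integral_eq_integral)
  then show ?thesis by (simp add: Lnorm_def Let_def)
qed

lemma Lnorm_2:
  assumes [measurable]: "u \<in> borel_measurable (leb d)" and "Lnorm d 2 u < \<infinity>"
  shows "integrable (leb d) (\<lambda>v. (u v)\<^sup>2)"
    and "(enn2real (Lnorm d 2 u))\<^sup>2 = (\<integral>v. (u v)\<^sup>2 \<partial>leb d)"
proof -
  have eq: "\<bar>u v\<bar> powr 2 = (u v)\<^sup>2" for v by (cases "u v = 0") simp_all
  have fin: "(\<integral>\<^sup>+v. ennreal ((u v)\<^sup>2) \<partial>leb d) < \<infinity>"
    using assms(2) by (auto simp: Lnorm_def Let_def eq less_top split: if_splits)
  then show int: "integrable (leb d) (\<lambda>v. (u v)\<^sup>2)"
    by (intro integrableI_nonneg) auto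
  then have "(\<integral>\<^sup>+v. ennreal ((u v)\<^sup>2) \<partial>leb d) = ennreal (\<integral>v. (u v)\<^sup>2 \<partial>leb d)"
    by (simp add: nn_integral_eq_integral)
  then show "(enn2real (Lnorm d 2 u))\<^sup>2 = (\<integral>v. (u v)\<^sup>2 \<partial>leb d)"
    by (simp add: Lnorm_def Let_def eq powr_half_sqrt)
qed

section \<open>Comparison of a density with the equilibrium of the same mass\<close>

context
  fixes d :: nat and f :: "(nat \<Rightarrow> real) \<Rightarrow> real" and \<beta> :: real
  assumes d: "d \<ge> 1" and f_int: "integrable (leb d) f" and f_nonneg: "AE v in leb d. f v \<ge> 0"
    and \<beta>: "\<beta> \<ge> 1" and mass_eq: "mass d (f_inf d \<beta>) = mass d f"
begin

lemma AE_f_inf_pos: "AE v in leb d. f_inf d \<beta> v > 0"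
  using AE_norm_sq_pos[OF d] by eventually_elim (rule f_inf_pos[OF _ \<beta>])

lemma mass_f_inf: "mass d (f_inf d \<beta>) = ennreal (\<integral>v. f v \<partial>leb d)"
  using f_int f_nonneg by (simp add: mass_eq) (simp add: mass_def nn_integral_eq_integral)

lemma integrable_f_inf: "integrable (leb d) (f_inf d \<beta>)"
proof (rule integrableI_nonneg)
  show "AE v in leb d. 0 \<le> f_inf d \<beta> v" using AE_f_inf_pos by eventually_elim simp
  show "(\<integral>\<^sup>+v. ennreal (f_inf d \<beta> v) \<partial>leb d) < \<infinity>"
    using mass_f_inf by (simp add: mass_def)
qed measurable

lemma integral_f_inf: "(\<integral>v. f_inf d \<beta> v \<partial>leb d) = (\<integral>v. f v \<partial>leb d)"
proof -
  have "AE v in leb d. 0 \<le> f_inf d \<beta> v" using AE_f_inf_pos by eventually_elim simp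
  then show ?thesis using mass_f_inf f_nonneg integrable_f_inf
    by (simp add: mass_def nn_integral_eq_integral integral_nonneg_AE)
qed

text \<open>Domination by the equilibrium itself, since \<open>0 \<le> ln (1 + x) \<le> x\<close>
  for \<open>x \<ge> 0\<close>.\<close>

lemma integrable_ln_f_inf: "integrable (leb d) (\<lambda>v. ln (f_inf d \<beta> v + 1))"
proof (rule Bochner_Integration.integrable_bound[OF integrable_f_inf])
  show "AE v in leb d. norm (ln (f_inf d \<beta> v + 1)) \<le> norm (f_inf d \<beta> v)"
    using AE_f_inf_pos
  proof eventually_elim
    case (elim v)
    then show ?case using ln_add_one_self_le_self[of "f_inf d \<beta> v"] by (simp add: add.commute)
  qed
qed measurable

lemma integrable_entropy_density_f_inf: "integrable (leb d) (entropy_density d (f_inf d \<beta>))"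
proof -
  have "AE v in leb d. - ln \<beta> * f_inf d \<beta> v - ln (f_inf d \<beta> v + 1) = entropy_density d (f_inf d \<beta>) v"
    using AE_norm_sq_pos[OF d] by eventually_elim (rule entropy_density_f_inf[OF _ \<beta>, symmetric])
  moreover have "integrable (leb d) (\<lambda>v. - ln \<beta> * f_inf d \<beta> v - ln (f_inf d \<beta> v + 1))"
    by (intro Bochner_Integration.integrable_diff integrable_mult_right integrable_f_inf
        integrable_ln_f_inf)
  ultimately show ?thesis
    by (subst integrable_cong_AE[symmetric]) auto
qed

lemma AE_bose_div_nonneg: "AE v in leb d. bose_div (f v) (f_inf d \<beta> v) \<ge> 0"
  using AE_f_inf_pos f_nonneg by eventually_elim (rule bose_div_nonneg)

text \<open>In the difference of the two entropy densities the terms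
  \<open>ln (f_inf d \<beta> v + 1)\<close> cancel. The multiplier term that remains has integral
  zero because the masses agree.\<close>

lemma AE_bose_div_eq:
  "AE v in leb d. bose_div (f v) (f_inf d \<beta> v) =
     entropy_density d f v - entropy_density d (f_inf d \<beta>) v + ln \<beta> * (f v - f_inf d \<beta> v)"
  using AE_norm_sq_pos[OF d]
  by eventually_elim
    (simp add: entropy_density_eq_bose_div[OF _ \<beta>, of d _ f] entropy_density_f_inf[OF _ \<beta>]
      algebra_simps)

lemma H_diff_f_inf:
  assumes e: "integrable (leb d) (entropy_density d f)"
  shows "integrable (leb d) (\<lambda>v. bose_div (f v) (f_inf d \<beta> v))"
    and "H d f - H d (f_inf d \<beta>) = ereal (\<integral>v. bose_div (f v) (f_inf d \<beta> v) \<partial>leb d)"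
proof -
  let ?r = "\<lambda>v. entropy_density d f v - entropy_density d (f_inf d \<beta>) v
      + ln \<beta> * (f v - f_inf d \<beta> v)"
  have [measurable]: "f \<in> borel_measurable (leb d)" using f_int by simp
  have meas [measurable]: "(\<lambda>v. bose_div (f v) (f_inf d \<beta> v)) \<in> borel_measurable (leb d)"
    unfolding bose_div_def by measurable
  note [simp] = e f_int integrable_f_inf integrable_entropy_density_f_inf
  have r: "integrable (leb d) ?r" by simp
  then show "integrable (leb d) (\<lambda>v. bose_div (f v) (f_inf d \<beta> v))"
    using AE_bose_div_eq by (subst integrable_cong_AE) auto
  have "(\<integral>v. bose_div (f v) (f_inf d \<beta> v) \<partial>leb d) = (\<integral>v. ?r v \<partial>leb d)"
    using AE_bose_div_eq r by (intro integral_cong_AE) auto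
  also have "\<dots> = (\<integral>v. entropy_density d f v \<partial>leb d) - (\<integral>v. entropy_density d (f_inf d \<beta>) v \<partial>leb d)"
    by (simp add: integral_f_inf)
  finally show "H d f - H d (f_inf d \<beta>) = ereal (\<integral>v. bose_div (f v) (f_inf d \<beta> v) \<partial>leb d)"
    by (simp add: H_eq_integral)
qed

text \<open>Dropping the non-negative divergence from the identity for the entropy densities leaves
  an integrable minorant of the density of \<open>f\<close>.\<close>

lemma H_eq_PInf_or_integrable:
  "H d f = \<infinity> \<or> integrable (leb d) (entropy_density d f)"
proof -
  let ?u = "\<lambda>v. entropy_density d (f_inf d \<beta>) v - ln \<beta> * (f v - f_inf d \<beta> v)"
  have "integrable (leb d) ?u"
    using f_int integrable_f_inf integrable_entropy_density_f_inf by simp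
  moreover have "AE v in leb d. ?u v \<le> entropy_density d f v"
    using AE_bose_div_eq AE_bose_div_nonneg by eventually_elim simp
  ultimately show ?thesis
    using H_eq_PInf[of f d ?u] f_int by auto
qed

text \<open>\<open>|x| = 2 * max 0 (- x) + x\<close>, and \<open>f - f_inf d \<beta>\<close>
  integrates to zero.\<close>

lemma integral_abs_diff:
  "(\<integral>v. \<bar>f v - f_inf d \<beta> v\<bar> \<partial>leb d) = 2 * (\<integral>v. max 0 (f_inf d \<beta> v - f v) \<partial>leb d)"
proof -
  have "\<bar>f v - f_inf d \<beta> v\<bar> = 2 * max 0 (f_inf d \<beta> v - f v) + (f v - f_inf d \<beta> v)" for v
    by (simp add: max_def)
  then show ?thesis using f_int integrable_f_inf by (simp add: integral_f_inf)
qed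

lemma square_integral_abs_diff_le:
  assumes g2: "integrable (leb d) (\<lambda>v. (f_inf d \<beta> v)\<^sup>2)"
    and D: "integrable (leb d) (\<lambda>v. bose_div (f v) (f_inf d \<beta> v))"
    and S: "S > 0" "S \<ge> (\<integral>v. f_inf d \<beta> v \<partial>leb d) + (\<integral>v. (f_inf d \<beta> v)\<^sup>2 \<partial>leb d)"
  shows "(\<integral>v. \<bar>f v - f_inf d \<beta> v\<bar> \<partial>leb d)\<^sup>2 \<le> 8 * S * (\<integral>v. bose_div (f v) (f_inf d \<beta> v) \<partial>leb d)"
proof -
  define W where "W = (\<integral>v. max 0 (f_inf d \<beta> v - f v) \<partial>leb d)"
  define I where "I = (\<integral>v. bose_div (f v) (f_inf d \<beta> v) \<partial>leb d)"
  define T where "T = (\<integral>v. f_inf d \<beta> v * (f_inf d \<beta> v + 1) \<partial>leb d)"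
  have gg: "f_inf d \<beta> v * (f_inf d \<beta> v + 1) = (f_inf d \<beta> v)\<^sup>2 + f_inf d \<beta> v" for v
    by (simp add: algebra_simps power2_eq_square)
  have T: "integrable (leb d) (\<lambda>v. f_inf d \<beta> v * (f_inf d \<beta> v + 1))" "T \<le> S"
    unfolding T_def gg using g2 integrable_f_inf S by simp_all
  have "W \<ge> 0" unfolding W_def by (rule integral_nonneg_AE) simp
  have "I \<ge> 0" unfolding I_def by (rule integral_nonneg_AE) (rule AE_bose_div_nonneg)
  have young: "W \<le> a * I + T / (2 * a)" if a: "a > 0" for a
  proof -
    have "W \<le> (\<integral>v. a * bose_div (f v) (f_inf d \<beta> v)
        + f_inf d \<beta> v * (f_inf d \<beta> v + 1) / (2 * a) \<partial>leb d)"
      unfolding W_def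
    proof (rule integral_mono_AE)
      show "AE v in leb d. max 0 (f_inf d \<beta> v - f v) \<le> a * bose_div (f v) (f_inf d \<beta> v)
          + f_inf d \<beta> v * (f_inf d \<beta> v + 1) / (2 * a)"
        using AE_f_inf_pos f_nonneg
        by eventually_elim (rule pos_part_le_bose_div[OF _ _ a])
    qed (use f_int integrable_f_inf D T in simp_all)
    also have "\<dots> = a * I + T / (2 * a)" using D T by (simp add: I_def T_def)
    finally show ?thesis .
  qed
  have "W\<^sup>2 \<le> 2 * S * I"
  proof (cases "W = 0")
    case False
    then have W: "W > 0" using \<open>W \<ge> 0\<close> by simp
    \<comment> \<open>With \<open>a = S / W\<close> the second term is at most \<open>W / 2\<close>,
      since \<open>T \<le> S\<close>, and is absorbed into the left-hand side.\<close>
    have "W \<le> S / W * I + T / (2 * (S / W))" using W S by (intro young) simp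
    also have "T / (2 * (S / W)) = T / S * (W / 2)" using W S by (simp add: field_simps)
    also have "\<dots> \<le> 1 * (W / 2)" using W S T by (intro mult_right_mono) auto
    finally have "W \<le> 2 * S * I / W" by simp
    then show ?thesis using W by (simp add: field_simps power2_eq_square)
  qed (use S \<open>I \<ge> 0\<close> in simp)
  \<comment> \<open>The factor 8 arises because the integral of the absolute difference is
    \<open>2 * W\<close>, whose square is at most \<open>4 * (2 * S * I)\<close>.\<close>
  then show ?thesis
    unfolding integral_abs_diff by (simp add: W_def I_def power_mult_distrib)
qed

end

section \<open>The entropy inequality with a constant independent of the dimension\<close>

theorem lemma4p5:
  shows "\<exists>C :: ennreal \<Rightarrow> ennreal \<Rightarrow> real.
    (\<forall>m n. 0 \<le> C m n) \<and>
    (\<forall>m n. n < \<infinity> \<longrightarrow> 0 < C m n) \<and>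
    (\<forall>(d::nat) (f :: (nat \<Rightarrow> real) \<Rightarrow> real) (\<beta>::real).
       d \<ge> 1 \<longrightarrow>
       integrable (leb d) f \<longrightarrow>
       (AE v in leb d. f v \<ge> 0) \<longrightarrow>
       mass d f \<le> critical_mass d \<longrightarrow>
       \<beta> \<ge> 1 \<longrightarrow>
       mass d (f_inf d \<beta>) = mass d f \<longrightarrow>
       H d f - H d (f_inf d \<beta>) \<ge>
         ereal (C (Lnorm d 1 (f_inf d \<beta>)) (Lnorm d 2 (f_inf d \<beta>)))
           * (enn2ereal (Lnorm d 1 (\<lambda>v. f v - f_inf d \<beta> v)))\<^sup>2)"
proof -
  \<comment> \<open>The summand 1 keeps the denominator positive, also for infinite
    \<open>m\<close>, where \<open>enn2real\<close> gives 0. For infinite \<open>n\<close>, which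
    occurs for \<open>\<beta> = 1\<close> in dimensions 3 and 4, the value 0 reduces the claim to
    the minimality of the equilibrium.\<close>
  define C :: "ennreal \<Rightarrow> ennreal \<Rightarrow> real" where
    "C m n = (if n < \<infinity> then 1 / (8 * (enn2real m + (enn2real n)\<^sup>2 + 1)) else 0)" for m n
  have denom: "enn2real m + (enn2real n)\<^sup>2 + 1 > 0" for m n
    by (intro add_nonneg_pos add_nonneg_nonneg) auto
  show ?thesis
  proof (intro exI[of _ C] conjI allI impI)
    show "0 \<le> C m n" for m n using denom[of m n] by (simp add: C_def)
    show "0 < C m n" if "n < \<infinity>" for m n using denom[of m n] that by (simp add: C_def)
    fix d :: nat and f :: "(nat \<Rightarrow> real) \<Rightarrow> real" and \<beta> :: real
    assume *: "d \<ge> 1" "integrable (leb d) f" "AE v in leb d. f v \<ge> 0"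
      "\<beta> \<ge> 1" "mass d (f_inf d \<beta>) = mass d f"
    let ?g = "f_inf d \<beta>"
    let ?c = "C (Lnorm d 1 ?g) (Lnorm d 2 ?g)"
    define L where "L = (\<integral>v. \<bar>f v - ?g v\<bar> \<partial>leb d)"
    define I where "I = (\<integral>v. bose_div (f v) (?g v) \<partial>leb d)"
    note g_int = integrable_f_inf[OF *]
    have "L \<ge> 0" by (simp add: L_def)
    moreover have "Lnorm d 1 (\<lambda>v. f v - ?g v) = ennreal L"
      unfolding L_def using *(2) g_int by (intro Lnorm_1) simp
    ultimately have L: "enn2ereal (Lnorm d 1 (\<lambda>v. f v - ?g v)) = ereal L"
      by simp
    have "ereal (?c * L\<^sup>2) \<le> H d f - H d ?g"
    proof (cases "integrable (leb d) (entropy_density d f)")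
      case False
      then have "H d f = \<infinity>" using H_eq_PInf_or_integrable[OF *] by blast
      \<comment> \<open>The entropy of the equilibrium is finite, so the difference is
        infinite.\<close>
      then show ?thesis by (simp add: H_eq_integral[OF integrable_entropy_density_f_inf[OF *]])
    next
      case True
      note D = H_diff_f_inf[OF * True]
      have "?c * L\<^sup>2 \<le> I"
      proof (cases "Lnorm d 2 ?g < \<infinity>")
        case True
        define S where "S = enn2real (Lnorm d 1 ?g) + (enn2real (Lnorm d 2 ?g))\<^sup>2 + 1"
        have "S > 0" unfolding S_def by (rule denom)
        have "(\<integral>v. ?g v \<partial>leb d) \<le> (\<integral>v. \<bar>?g v\<bar> \<partial>leb d)"
          using g_int by (intro integral_mono) auto
        also have "\<dots> = enn2real (Lnorm d 1 ?g)" by (simp add: Lnorm_1[OF g_int])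
        finally have "(\<integral>v. ?g v \<partial>leb d) + (\<integral>v. (?g v)\<^sup>2 \<partial>leb d) \<le> S"
          using Lnorm_2(2)[OF borel_measurable_f_inf True] by (simp add: S_def)
        then have "L\<^sup>2 \<le> 8 * S * I" unfolding L_def I_def
          using Lnorm_2(1)[OF borel_measurable_f_inf True] D(1) \<open>S > 0\<close>
          by (intro square_integral_abs_diff_le[OF *]) auto
        moreover have "?c = 1 / (8 * S)" using True by (simp add: C_def S_def)
        ultimately show ?thesis using \<open>S > 0\<close> by (simp add: pos_divide_le_eq mult.commute)
      next
        case False
        \<comment> \<open>Here \<open>?c = 0\<close>, and only \<open>I \<ge> 0\<close>
          remains.\<close>
        then show ?thesis
          unfolding I_def using AE_bose_div_nonneg[OF *] by (simp add: C_def integral_nonneg_AE)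
      qed
      then show ?thesis by (simp add: D(2) I_def)
    qed
    then show "ereal ?c * (enn2ereal (Lnorm d 1 (\<lambda>v. f v - ?g v)))\<^sup>2 \<le> H d f - H d ?g"
      by (simp add: L)
  qed
qed

end
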